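(* Let $k$ be a finite field with $q$ elements, let $f>0$ be an integer, let $k_f$ be the extension of $k$ of degree $f$, $G_f=\mathrm{Gal}(k_f|k)$, and let $e>0$ be an integer such that $q^f\equiv1\pmod e$. Let $N_f:k_f^\times\to k^\times$ be the norm map. Consider the canonical isomorphism $$H^2(G_f,k_f^\times/k_f^{\times e})_q\to H^2(G_f,{}_ek_f^\times)_q$$ induced by the isomorphism of $G_f$-modules $k_f^\times/k_f^{\times e}\to{}_ek_f^\times$, $\bar\xi\mapsto\xi^{(q^f-1)/e}$. Then for every $\xi\in k_f^\times$ such that $\xi^{q-1}\in k_f^{\times e}$, and every $\alpha\in k_f^\times$ such that $\xi^{q-1}=\alpha^e$, this isomorphism sends the class $[\bar\xi]$ to the class $[\zeta]$ of $\zeta=N_f(\alpha)$.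
   Context: ${}_ek_f^\times$ is the group of $e$-th roots of $1$ in $k_f^\times$. $G_f$ is cyclic, with canonical generator $x\mapsto x^q$. For a $G_f$-module $C$ on which this generator acts by $x\mapsto x^q$, $H^2(G_f,C)_q$ is the kernel of $x\mapsto x^{q-1}$ on $C$ modulo the image of $x\mapsto x^{1+q+\cdots+q^{f-1}}$ on $C$. For $\xi\in k_f^\times$ with $\xi^{q-1}\in k_f^{\times e}$, the image $\bar\xi\in k_f^\times/k_f^{\times e}$ satisfies $\bar\xi^{\,q-1}=1$ and $[\bar\xi]$ is its class in $H^2(G_f,k_f^\times/k_f^{\times e})_q$. If $\xi^{q-1}=\alpha^e$, then $\zeta=N_f(\alpha)$ lies in ${}_ek_f^\times$ and satisfies $\zeta^{q-1}=1$; $[\zeta]$ is its class in $H^2(G_f,{}_ek_f^\times)_q$. *)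

theory Defs
  imports
    "HOL-Algebra.Embedded_Algebras"
    "HOL-Algebra.QuotRing"
    "HOL-Algebra.Group_Action"
    "HOL-Number_Theory.Cong"
begin

text \<open>
  A field extension is given by a field \<open>L\<close> and a subfield \<open>K\<close> of it.  The automorphisms in the
  Galois group are extensional functions on \<open>carrier L\<close>, so that they have unique representatives.
\<close>

definition galois_group :: "('a, 'b) ring_scheme \<Rightarrow> 'a set \<Rightarrow> ('a \<Rightarrow> 'a) monoid" where
  "galois_group L K =
     (BijGroup (carrier L))
       \<lparr>carrier := {\<sigma> \<in> extensional (carrier L) \<inter> ring_iso L L. \<forall>x\<in>K. \<sigma> x = x}\<rparr>"

definition frobenius :: "('a, 'b) ring_scheme \<Rightarrow> nat \<Rightarrow> 'a \<Rightarrow> 'a" where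
  "frobenius L q = (\<lambda>x\<in>carrier L. x [^]\<^bsub>L\<^esub> q)"

text \<open>The norm of a finite Galois extension: the product of the conjugates.\<close>

definition galois_norm :: "('a, 'b) ring_scheme \<Rightarrow> 'a set \<Rightarrow> 'a \<Rightarrow> 'a" where
  "galois_norm L K x = (\<Otimes>\<^bsub>L\<^esub>\<sigma>\<in>carrier (galois_group L K). \<sigma> x)"

locale group_module = comm_group C + group_action G "carrier C" act
  for G :: "('g, 'h) monoid_scheme" and C :: "('c, 'd) monoid_scheme" (structure)
    and act :: "'g \<Rightarrow> 'c \<Rightarrow> 'c" +
  assumes act_hom: "g \<in> carrier G \<Longrightarrow> act g \<in> hom C C"

definition group_module_iso ::
  "('g, 'h) monoid_scheme \<Rightarrow> ('c, 'm) monoid_scheme \<Rightarrow> ('g \<Rightarrow> 'c \<Rightarrow> 'c)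
    \<Rightarrow> ('d, 'n) monoid_scheme \<Rightarrow> ('g \<Rightarrow> 'd \<Rightarrow> 'd) \<Rightarrow> ('c \<Rightarrow> 'd) set" where
  "group_module_iso G C act D act' =
     {\<phi> \<in> iso C D. \<forall>g\<in>carrier G. \<forall>x\<in>carrier C. \<phi> (act g x) = act' g (\<phi> x)}"

text \<open>
  \<open>H2q q f C\<close> is meant for a module \<open>C\<close> over a cyclic group of order \<open>f\<close> whose canonical
  generator acts by \<open>x \<mapsto> x\<^sup>q\<close>.  It is then the second cohomology group in its usual form for
  cyclic groups, invariants modulo norms, and the action no longer occurs in the formula.  The
  image of the norm lies in the kernel of \<open>x \<mapsto> x [^] (q - 1)\<close> since the \<open>f\<close>-th power of the
  generator is the identity.
\<close>

definition H2q_norms :: "nat \<Rightarrow> nat \<Rightarrow> ('c, 'm) monoid_scheme \<Rightarrow> 'c set" where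
  "H2q_norms q f C = (\<lambda>x. x [^]\<^bsub>C\<^esub> (\<Sum>i<f. q ^ i)) ` carrier C"

definition H2q :: "nat \<Rightarrow> nat \<Rightarrow> ('c, 'm) monoid_scheme \<Rightarrow> 'c set monoid" where
  "H2q q f C =
     C\<lparr>carrier := kernel C C (\<lambda>x. x [^]\<^bsub>C\<^esub> (q - 1))\<rparr> Mod H2q_norms q f C"

definition H2q_class :: "nat \<Rightarrow> nat \<Rightarrow> ('c, 'm) monoid_scheme \<Rightarrow> 'c \<Rightarrow> 'c set" where
  "H2q_class q f C x = H2q_norms q f C #>\<^bsub>C\<^esub> x"

text \<open>
  The map induced by \<open>\<phi>\<close>, \<open>[x] \<mapsto> [\<phi> x]\<close>; \<open>the_elem\<close> picks the common value of the classes
  \<open>[\<phi> x]\<close>, for \<open>x\<close> running through a given coset.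
\<close>

definition H2q_map :: "nat \<Rightarrow> nat \<Rightarrow> ('d, 'n) monoid_scheme \<Rightarrow> ('c \<Rightarrow> 'd) \<Rightarrow> 'c set \<Rightarrow> 'd set" where
  "H2q_map q f D \<phi> = (\<lambda>S. the_elem ((\<lambda>x. H2q_class q f D (\<phi> x)) ` S))"

definition unit_powers :: "('a, 'b) ring_scheme \<Rightarrow> nat \<Rightarrow> 'a set" where
  "unit_powers L e = (\<lambda>x. x [^]\<^bsub>L\<^esub> e) ` carrier (units_of L)"

definition power_classes :: "('a, 'b) ring_scheme \<Rightarrow> nat \<Rightarrow> 'a set monoid" where
  "power_classes L e = units_of L Mod unit_powers L e"

definition class_mod_powers :: "('a, 'b) ring_scheme \<Rightarrow> nat \<Rightarrow> 'a \<Rightarrow> 'a set" where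
  "class_mod_powers L e x = unit_powers L e #>\<^bsub>units_of L\<^esub> x"

definition power_classes_act :: "('a, 'b) ring_scheme \<Rightarrow> nat \<Rightarrow> ('a \<Rightarrow> 'a) \<Rightarrow> 'a set \<Rightarrow> 'a set" where
  "power_classes_act L e \<sigma> = (\<lambda>S\<in>carrier (power_classes L e). \<sigma> ` S)"

definition unity_roots :: "('a, 'b) ring_scheme \<Rightarrow> nat \<Rightarrow> 'a monoid" where
  "unity_roots L e =
     (units_of L)\<lparr>carrier := {x \<in> carrier (units_of L). x [^]\<^bsub>L\<^esub> e = \<one>\<^bsub>L\<^esub>}\<rparr>"

definition unity_roots_act :: "('a, 'b) ring_scheme \<Rightarrow> nat \<Rightarrow> ('a \<Rightarrow> 'a) \<Rightarrow> 'a \<Rightarrow> 'a" where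
  "unity_roots_act L e \<sigma> = (\<lambda>x\<in>carrier (unity_roots L e). \<sigma> x)"

text \<open>
  The map on classes modulo \<open>e\<close>-th powers induced by \<open>x \<mapsto> x [^] ((n - 1) div e)\<close>, where \<open>n\<close> is
  the number of elements of \<open>L\<close>.
\<close>

definition power_classes_to_roots :: "('a, 'b) ring_scheme \<Rightarrow> nat \<Rightarrow> nat \<Rightarrow> 'a set \<Rightarrow> 'a" where
  "power_classes_to_roots L n e =
     (\<lambda>S. the_elem ((\<lambda>x. x [^]\<^bsub>L\<^esub> ((n - 1) div e)) ` S))"

end

theory Submission
  imports
    Defs
    "HOL-Algebra.Finite_Extensions"
    "HOL-Algebra.Multiplicative_Group"
    "HOL-Algebra.Sylow"
begin

text \<open>
  Everything is read off a generator \<open>g\<close> of the cyclic group of units of \<open>L\<close>, which has order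
  \<open>M = q\<^sup>f - 1\<close>.  Put \<open>n = M / e\<close> and \<open>s = 1 + q + \<dots> + q\<^bsup>f - 1\<^esup> = M / (q - 1)\<close>.  The Galois
  automorphisms are the maps \<open>x \<mapsto> x\<^bsup>q^i\<^esup>\<close> with \<open>i < f\<close>: they are distinct, and there are at
  most \<open>f\<close> automorphisms since each is determined by the image of \<open>g\<close>, a root of the minimal
  polynomial of \<open>g\<close> over \<open>K\<close>.  Hence the norm is \<open>x \<mapsto> x\<^sup>s\<close>.  The \<open>e\<close>-th powers are the kernel of
  \<open>x \<mapsto> x\<^sup>n\<close> and the \<open>e\<close>-th roots of unity are its image, which gives the isomorphism of modules.
  Finally, if \<open>\<xi>\<^bsup>q - 1\<^esup> = \<alpha>\<^sup>e\<close>, then \<open>\<xi>\<^sup>n\<close> and \<open>\<alpha>\<^sup>s\<close> differ by \<open>y\<^sup>s\<close> for some \<open>y\<close> with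
  \<open>y\<^sup>e = 1\<close>.
\<close>

section \<open>Frobenius maps and finite extensions\<close>


lemma (in cring) binomial_finsum:
  assumes x: "x \<in> carrier R" and y: "y \<in> carrier R"
  shows "(x \<oplus> y) [^] n = (\<Oplus>k\<in>{..n}. [(n choose k)] \<cdot> (x [^] k \<otimes> y [^] (n - k)))"
proof (induction n)
  case 0
  then show ?case using assms by simp
next
  case (Suc n)
  let ?t = "\<lambda>m k. [(m choose k)] \<cdot> (x [^] k \<otimes> y [^] (m - k))"
  have t: "?t m \<in> A \<rightarrow> carrier R" for m A using x y by auto
  let ?u = "\<lambda>c k. [c k] \<cdot> (x [^] Suc k \<otimes> y [^] (n - k))"
  have u: "?u c \<in> A \<rightarrow> carrier R" for c :: "nat \<Rightarrow> nat" and A using x y by auto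
  have "(\<Oplus>k\<in>{..n}. ?t n k) \<otimes> x = (\<Oplus>k\<in>{..n}. ?t n k \<otimes> x)"
    by (rule finsum_ldistr) (use x t in auto)
  also have "\<dots> = (\<Oplus>k\<in>{..n}. ?u (\<lambda>k. n choose k) k)"
    by (rule finsum_cong') (use x y in \<open>auto simp: add_pow_ldistr add_pow_rdistr m_ac\<close>)
  finally have 1: "(\<Oplus>k\<in>{..n}. ?t n k) \<otimes> x = (\<Oplus>k\<in>{..n}. ?u (\<lambda>k. n choose k) k)" .
  let ?v = "\<lambda>k. [(n choose k)] \<cdot> (x [^] k \<otimes> y [^] (Suc n - k))"
  have v: "?v \<in> A \<rightarrow> carrier R" for A using x y by auto
  have "(\<Oplus>k\<in>{..n}. ?t n k) \<otimes> y = (\<Oplus>k\<in>{..n}. ?t n k \<otimes> y)"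
    by (rule finsum_ldistr) (use y t in auto)
  also have "\<dots> = (\<Oplus>k\<in>{..n}. ?v k)"
    by (rule finsum_cong') (use x y in \<open>auto simp: add_pow_ldistr m_assoc Suc_diff_le\<close>)
  \<comment> \<open>The extra term \<open>k = Suc n\<close> is zero because
    \<open>n choose Suc n\<close> is. With it the index can be shifted, leaving the term
    \<open>k = 0\<close>, which is \<open>y [^] Suc n\<close>, apart.\<close>
  also have "\<dots> = (\<Oplus>k\<in>{..Suc n}. ?v k)"
    using finsum_Suc[OF v, of n] finsum_closed[OF v] x by (simp add: binomial_eq_0)
  also have "\<dots> = (\<Oplus>k\<in>{..n}. ?u (\<lambda>k. n choose Suc k) k) \<oplus> y [^] Suc n"
    using finsum_Suc2[OF v, of n] y by simp
  finally have 2: "(\<Oplus>k\<in>{..n}. ?t n k) \<otimes> y = (\<Oplus>k\<in>{..n}. ?u (\<lambda>k. n choose Suc k) k) \<oplus> y [^] Suc n" .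
  have "(\<Oplus>k\<in>{..Suc n}. ?t (Suc n) k) = (\<Oplus>k\<in>{..n}. ?u (\<lambda>k. Suc n choose Suc k) k) \<oplus> y [^] Suc n"
    using finsum_Suc2[OF t, of "Suc n" n] y by simp
  \<comment> \<open>Pascal's rule, applied termwise after the term \<open>k = 0\<close> has been
    split off.\<close>
  also have "(\<Oplus>k\<in>{..n}. ?u (\<lambda>k. Suc n choose Suc k) k)
      = (\<Oplus>k\<in>{..n}. ?u (\<lambda>k. n choose k) k \<oplus> ?u (\<lambda>k. n choose Suc k) k)"
    by (rule finsum_cong') (use x y in \<open>auto simp: add.nat_pow_mult\<close>)
  also have "\<dots> = (\<Oplus>k\<in>{..n}. ?u (\<lambda>k. n choose k) k) \<oplus> (\<Oplus>k\<in>{..n}. ?u (\<lambda>k. n choose Suc k) k)"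
    by (rule finsum_addf[OF u u])
  finally show ?case
    using Suc 1 2 x y finsum_closed[OF u] finsum_closed[OF t] by (simp add: r_distr a_assoc)
qed

lemma (in cring) add_pow_dvd_zero:
  assumes "[(p::nat)] \<cdot> \<one> = \<zero>" "p dvd n" "z \<in> carrier R"
  shows "[n] \<cdot> z = \<zero>"
proof -
  obtain k where k: "n = p * k" using assms(2) by blast
  have "[n] \<cdot> \<one> = \<zero>"
    using assms(1) add.nat_pow_pow[of \<one> k p] add.nat_pow_one[of k] k by (simp add: mult.commute)
  then show ?thesis
    using add_pow_ldistr[of \<one> z n] assms(3) by simp
qed

text \<open>For 0 < k < p the coefficient \<open>p choose k\<close> is divisible by
  \<open>p\<close>, so only the two outer terms of the binomial expansion survive.\<close>

lemma (in cring) prime_char_power_add: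
  assumes p: "Factorial_Ring.prime (p::nat)" "[p] \<cdot> \<one> = \<zero>" and x: "x \<in> carrier R" and y: "y \<in> carrier R"
  shows "(x \<oplus> y) [^] p = x [^] p \<oplus> y [^] p"
proof -
  let ?t = "\<lambda>k. [(p choose k)] \<cdot> (x [^] k \<otimes> y [^] (p - k))"
  have t: "?t \<in> A \<rightarrow> carrier R" for A using x y by auto
  obtain m where m: "p = Suc m" using p(1) prime_gt_0_nat gr0_conv_Suc by blast
  have "(x \<oplus> y) [^] p = ?t p \<oplus> (\<Oplus>k\<in>{..m}. ?t k)"
    using binomial_finsum[OF x y, of p] finsum_Suc[OF t, of m] m by simp
  also have "(\<Oplus>k\<in>{..m}. ?t k) = (\<Oplus>k\<in>{..m}. if 0 = k then y [^] p else \<zero>)"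
  proof (rule finsum_cong')
    show "?t k = (if 0 = k then y [^] p else \<zero>)" if "k \<in> {..m}" for k
    proof (cases "k = 0")
      case False
      then have "p dvd p choose k"
        using that m by (intro dvd_choose_prime p) auto
      then show ?thesis using False add_pow_dvd_zero[OF p(2)] x y by simp
    qed (use y in simp)
  qed (use y in auto)
  also have "\<dots> = y [^] p"
    using add.finprod_singleton[of 0 "{..m}" "\<lambda>_. y [^] p"] y by simp
  finally show ?thesis using x y by simp
qed

text \<open>Stated for products of primes, so that no prime power decomposition of \<open>n\<close> is needed.\<close>
lemma (in cring) char_power_add:
  assumes "n > 0" and "\<And>r::nat. Factorial_Ring.prime r \<Longrightarrow> r dvd n \<Longrightarrow> [r] \<cdot> \<one> = \<zero>"
    and x: "x \<in> carrier R" and y: "y \<in> carrier R"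
  shows "(x \<oplus> y) [^] n = x [^] n \<oplus> y [^] n"
  using assms(1,2)
proof (induction n rule: less_induct)
  case (less n)
  show ?case
  proof (cases "n = 1")
    case False
    then obtain r where r: "Factorial_Ring.prime r" "r dvd n" using prime_factor_nat by blast
    then obtain k where k: "n = k * r" by (metis dvdE mult.commute)
    have "k < n" "k > 0" using k less.prems(1) prime_gt_1_nat[OF r(1)] by auto
    moreover have "[r'] \<cdot> \<one> = \<zero>" if "Factorial_Ring.prime r'" "r' dvd k" for r'
      using less.prems(2) that k by simp
    ultimately have "(x \<oplus> y) [^] k = x [^] k \<oplus> y [^] k" using less.IH by blast
    then show ?thesis
      using prime_char_power_add[OF r(1) less.prems(2)[OF r]] x y
      by (simp add: k nat_pow_pow[symmetric])
  qed (use x y in simp)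
qed

section \<open>Characteristic and cardinality\<close>

text \<open>Cauchy's theorem, here Sylow's theorem with exponent 1, gives a subgroup of order
  \<open>r\<close> in the additive group of \<open>K\<close>. A nonzero element of it is killed by
  \<open>r\<close> and can be cancelled. This supplies the characteristic condition of
  \<open>char_power_add\<close>.\<close>

lemma (in field) prime_dvd_card_subfield:
  assumes K: "subfield K R" "finite K" and r: "Factorial_Ring.prime r" "r dvd card K"
  shows "[r] \<cdot> \<one> = \<zero>"
proof -
  have sg: "subgroup K (add_monoid R)"
    using subring.axioms(1)[OF subfieldE(1)[OF K(1)]] .
  let ?G = "add_monoid R\<lparr>carrier := K\<rparr>"
  have G: "Group.group ?G" using subgroup.subgroup_is_group[OF sg] add.group_axioms by blast
  obtain H where H: "subgroup H ?G" "card H = r"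
    using sylow_thm[of r ?G 1 "card K div r"] r G K(2) by (auto simp: order_def)
  have "\<not> H \<subseteq> {\<zero>}" using H(2) prime_gt_1_nat[OF r(1)] card_mono[of "{\<zero>}" H] by auto
  then obtain x where x: "x \<in> H" "x \<noteq> \<zero>" by auto
  have HG: "subgroup H (add_monoid R)" 
    using add.incl_subgroup[OF sg H(1)] .
  have xc: "x \<in> carrier R" using x(1) subgroup.subset[OF HG] by auto
  have "x [^]\<^bsub>add_monoid R\<lparr>carrier := H\<rparr>\<^esub> card H = \<zero>"
    using group.pow_order_eq_1[OF subgroup.subgroup_is_group[OF HG add.group_axioms]] x(1) 
    by (simp add: order_def)
  then have "[r] \<cdot> x = \<zero>" using H(2) add.nat_pow_consistent[of r x H] by (simp add: add_pow_def)
  then have "([r] \<cdot> \<one>) \<otimes> x = \<zero>" using add_pow_ldistr[of \<one> x r] xc by simp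
  then show ?thesis using integral xc x(2) by blast
qed

text \<open>Induction on the dimension: a space of dimension \<open>Suc n\<close> arises from
  \<open>E'\<close> by adjoining some \<open>v\<close> outside it, and (k, u) \<mapsto> k v + u is a
  bijection from \<open>K \<times> E'\<close> onto it.\<close>

lemma (in field) card_finite_dimension:
  assumes K: "subfield K R" "finite K" and "dimension n K E"
  shows "finite E \<and> card E = card K ^ n"
  using assms(3)
proof (induction n arbitrary: E)
  case 0
  then show ?case using dimension_zero[OF K(1) 0] by simp
next
  case (Suc n)
  obtain v E' where v: "v \<in> carrier R" "v \<notin> E'" "dimension n K E'" "E = line_extension K v E'"
    using dimension_backwards[OF K(1) Suc.prems] by auto
  have IH: "finite E'" "card E' = card K ^ n" using Suc.IH[OF v(3)] by auto
  have KR: "K \<subseteq> carrier R" using subfieldE(3)[OF K(1)] .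
  have E'R: "E' \<subseteq> carrier R" using space_subgroup_props(1)[OF K(1) v(3)] .
  let ?h = "\<lambda>(k, u). k \<otimes> v \<oplus> u"
  have E: "E = ?h ` (K \<times> E')"
    unfolding v(4) by (fastforce simp: line_extension_mem_iff image_iff)
  have inj: "inj_on ?h (K \<times> E')"
  proof (rule inj_onI, clarify)
    fix k u k' u' assume a: "k \<in> K" "u \<in> E'" "k' \<in> K" "u' \<in> E'" "k \<otimes> v \<oplus> u = k' \<otimes> v \<oplus> u'"
    have c: "k \<in> carrier R" "k' \<in> carrier R" "u \<in> carrier R" "u' \<in> carrier R" using a KR E'R by auto
    have "(k \<ominus> k') \<otimes> v = (k \<otimes> v \<oplus> u) \<ominus> (k' \<otimes> v \<oplus> u)"
      using c v(1) by algebra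
    also have "\<dots> = u' \<ominus> u"
      unfolding a(5) using c v(1) by algebra
    finally have e: "(k \<ominus> k') \<otimes> v = u' \<ominus> u" .
    have "u' \<ominus> u \<in> E'"
      using a space_subgroup_props(3,4)[OF K(1) v(3)] by (simp add: a_minus_def)
    moreover have "k \<ominus> k' \<in> K"
      using a K(1) subringE(5,7)[OF subfieldE(1)[OF K(1)]] by (simp add: a_minus_def)
    \<comment> \<open>Otherwise a nonzero scalar multiple of \<open>v\<close> would lie in
      \<open>E'\<close>, and then so would \<open>v\<close>.\<close>
    ultimately have "k \<ominus> k' = \<zero>"
      using v(1,2) e space_subgroup_props(6)[OF K(1) v(3), of "k \<ominus> k'" v] by auto
    then have "k = k'" using c r_right_minus_eq by blast
    then show "k = k' \<and> u = u'" using a(5) c v(1) by simp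
  qed
  then show ?case using IH K(2) by (simp add: E card_image card_cartesian_product)
qed


lemma (in field) pow_card_eq:
  assumes "finite (carrier R)" "x \<in> carrier R"
  shows "x [^] card (carrier R) = x"
proof (cases "x = \<zero>")
  case True
  moreover have "card (carrier R) \<noteq> 0" using assms by auto
  ultimately show ?thesis by (metis nat_pow_zero)
next
  case False
  have "card (carrier R) = Suc (card (Units R))"
    using assms(1) card_Suc_Diff1[of "carrier R" \<zero>] by (simp add: field_Units)
  moreover have "x [^] card (Units R) = \<one>"
    using units_power_order_eq_one assms False by (simp add: field_Units)
  ultimately show ?thesis using assms(2) by simp
qed

lemma (in comm_monoid) finprod_nat_pow:
  assumes "x \<in> carrier G"
  shows "(\<Otimes>i\<in>A. x [^] (n i :: nat)) = x [^] sum n A"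
proof (cases "finite A")
  case True
  then show ?thesis
    by (induction A rule: finite_induct) (use assms in \<open>simp_all add: nat_pow_mult\<close>)
qed simp

lemma geometric_sum_nat: "(\<Sum>i<f. q ^ i) * (q - 1) = q ^ f - (1::nat)"
proof (cases q)
  case (Suc p)
  have "(\<Sum>i<f. q ^ i) * p + 1 = q ^ f"
    by (induction f) (simp_all add: Suc algebra_simps)
  then show ?thesis using Suc by simp
\<comment> \<open>For \<open>q = 0\<close> both sides are 0, owing to truncated subtraction.\<close>
qed (cases f, simp_all)

section \<open>The Galois group of an extension of finite fields\<close>

locale finite_field_extension = field L for L (structure) +
  fixes K :: "'a set" and q f :: nat
  assumes subfield: "subfield K L" and finite_subfield: "finite K" and card_subfield: "card K = q"
    and degree_pos: "f > 0" and dim: "dimension f K (carrier L)"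
begin

lemma finite_carrier: "finite (carrier L)" and card_carrier: "card (carrier L) = q ^ f"
  using card_finite_dimension[OF subfield finite_subfield dim] card_subfield by auto

lemma q_gt_1: "q > 1"
proof -
  have "{\<zero>, \<one>} \<subseteq> K"
    using subringE(2,3)[OF subfieldE(1)[OF subfield]] by auto
  then have "card {\<zero>, \<one>} \<le> q"
    using card_mono finite_subfield card_subfield by blast
  then show ?thesis by simp
qed

lemma K_subset: "K \<subseteq> carrier L"
  using subfieldE(3)[OF subfield] .

lemma pow_card: "x \<in> carrier L \<Longrightarrow> x [^] (q ^ f) = x"
  using pow_card_eq[OF finite_carrier] card_carrier by simp

lemma card_Units: "card (Units L) = q ^ f - 1"
  using card_carrier finite_carrier by (simp add: field_Units)

lemma Units_pow_card: "x \<in> Units L \<Longrightarrow> x [^] (q ^ f - 1) = \<one>"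
  using units_power_order_eq_one finite_carrier card_Units by (simp add: field_Units)

text \<open>A counting argument: the q - 1 nonzero elements of \<open>K\<close> are roots of X^(q-1)
  - 1, which has at most q - 1 roots in \<open>L\<close>, so they are all of them.\<close>

lemma subfield_iff_pow: "x \<in> K \<longleftrightarrow> x \<in> carrier L \<and> x [^] q = x"
proof -
  have pow: "x [^] q = x" if "x \<in> K" for x
    using field.pow_card_eq[OF subfield_iff(2)[OF subfield], of x] that finite_subfield card_subfield
      nat_pow_consistent[of x q K] by simp
  let ?A = "{x \<in> carrier L. x [^] (q - 1) = \<one>}"
  have pow': "x [^] q = x [^] (q - 1) \<otimes> x" if "x \<in> carrier L" for x
    using q_gt_1 nat_pow_Suc[of x "q - 1"] by simp
  have A: "x [^] q = x \<longleftrightarrow> x \<in> ?A" if "x \<in> carrier L - {\<zero>}" for x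
    using that pow'[of x] m_rcancel[of x "x [^] (q - 1)" \<one>] by auto
  have "K - {\<zero>} \<subseteq> ?A" using pow A K_subset by auto
  moreover have "card ?A \<le> q - 1"
    using num_roots_le_deg[OF finite_carrier, of "q - 1"] q_gt_1 by simp
  moreover have "card (K - {\<zero>}) = q - 1"
    using subringE(2)[OF subfieldE(1)[OF subfield]] finite_subfield card_subfield by simp
  ultimately have "K - {\<zero>} = ?A"
    using finite_carrier by (intro card_seteq) auto
  then show ?thesis
    using pow A K_subset subringE(2)[OF subfieldE(1)[OF subfield]] by blast
qed

lemma pow_iter_card: "x \<in> carrier L \<Longrightarrow> x [^] (q ^ (f * j)) = x"
proof (induction j)
  case (Suc j)
  have "x [^] (q ^ (f * Suc j)) = (x [^] (q ^ f)) [^] (q ^ (f * j))"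
    using Suc.prems by (simp add: nat_pow_pow power_add)
  then show ?case using Suc pow_card by simp
qed simp

text \<open>The number \<open>f * i - i\<close> represents -i modulo f, and since f > 0 the
  subtraction is never truncated. It gives an explicit inverse of the \<open>q ^ i\<close>-th power
  map.\<close>

lemma pow_pow_inverse: 
  assumes "x \<in> carrier L"
  shows "(x [^] (q ^ i)) [^] (q ^ (f * i - i)) = x"
proof -
  have "i + (f * i - i) = f * i" using degree_pos by simp
  then show ?thesis
    using assms pow_iter_card[of x i] by (metis nat_pow_pow power_add)
qed

lemma pow_q_add:
  assumes "x \<in> carrier L" "y \<in> carrier L"
  shows "(x \<oplus> y) [^] (q ^ i) = x [^] (q ^ i) \<oplus> y [^] (q ^ i)"
proof (rule char_power_add)
  show "[r] \<cdot> \<one> = \<zero>" if "Factorial_Ring.prime r" "r dvd q ^ i" for r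
    using prime_dvd_card_subfield[OF subfield finite_subfield that(1)] 
      prime_dvd_power[OF that] card_subfield by simp
qed (use assms q_gt_1 in auto)

lemma carrier_galois_group:
  "carrier (galois_group L K) = {\<sigma> \<in> extensional (carrier L) \<inter> ring_iso L L. \<forall>x\<in>K. \<sigma> x = x}"
  by (simp add: galois_group_def)

text \<open>Injectivity comes from the explicit left inverse, surjectivity from finiteness of
  \<open>L\<close>, and additivity from the characteristic.\<close>

lemma frobenius_pow_in_galois_group: "frobenius L (q ^ i) \<in> carrier (galois_group L K)"
proof -
  have inj: "inj_on (frobenius L (q ^ i)) (carrier L)"
    using pow_pow_inverse by (intro inj_on_inverseI[where g = "\<lambda>x. x [^] (q ^ (f * i - i))"])
      (simp add: frobenius_def)
  have im: "frobenius L (q ^ i) ` carrier L \<subseteq> carrier L" by (auto simp: frobenius_def)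
  have bij: "bij_betw (frobenius L (q ^ i)) (carrier L) (carrier L)"
    using inj endo_inj_surj[OF finite_carrier im inj] by (simp add: bij_betw_def)
  have "x [^] (q ^ i) = x" if "x \<in> K" for x
    using that
  proof (induction i)
    case (Suc i)
    then show ?case using subfield_iff_pow[of x] by (simp add: nat_pow_pow[symmetric] mult.commute)
  qed (use K_subset in auto)
  moreover have "frobenius L (q ^ i) \<in> ring_iso L L"
    using bij by (intro ring_iso_memI) (simp_all add: frobenius_def pow_q_add nat_pow_distrib)
  ultimately show ?thesis
    using K_subset by (auto simp: carrier_galois_group frobenius_def)
qed

text \<open>If the maps for i < j < f agreed, all q^f - 1 units would be roots of X^d - 1 with d =
  q^(j-i) - 1, which is positive and smaller than q^f - 1.\<close>

lemma inj_on_frobenius_pow: "inj_on (\<lambda>i. frobenius L (q ^ i)) {..<f}"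
proof -
  have False if "i < j" "j < f" "frobenius L (q ^ i) = frobenius L (q ^ j)" for i j
  proof -
    have eq: "x [^] (q ^ i) = x [^] (q ^ j)" if "x \<in> carrier L" for x
      using fun_cong[OF \<open>frobenius L (q ^ i) = frobenius L (q ^ j)\<close>, of x] that by (simp add: frobenius_def)
    let ?d = "q ^ (j - i) - 1"
    have qd: "q ^ (j - i) = Suc ?d" using q_gt_1 by simp
    have "x [^] (q ^ (j - i)) = x" if x: "x \<in> carrier L" for x
    proof -
      have "(x [^] (q ^ (j - i))) [^] (q ^ i) = x [^] (q ^ j)"
        using x \<open>i < j\<close> by (simp add: nat_pow_pow power_add[symmetric])
      \<comment> \<open>The inverse of the \<open>q ^ i\<close>-th power map cancels the common
        exponent \<open>q ^ i\<close>.\<close>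
      then show ?thesis
        using eq[OF x] pow_pow_inverse[of "x [^] (q ^ (j - i))" i] pow_pow_inverse[of x i] x by simp
    qed
    then have "x [^] ?d = \<one>" if "x \<in> carrier L" "x \<noteq> \<zero>" for x
      using that nat_pow_Suc[of x ?d, folded qd] m_rcancel[of x "x [^] ?d" \<one>] by simp
    then have "Units L \<subseteq> {x \<in> carrier L. x [^] ?d = \<one>}"
      by (auto simp: field_Units)
    then have "card (Units L) \<le> card {x \<in> carrier L. x [^] ?d = \<one>}"
      using finite_carrier by (intro card_mono) auto
    moreover have gt: "?d > 0" using one_less_power[OF q_gt_1, of "j - i"] that by simp
    ultimately have "q ^ f - 1 \<le> ?d"
      using num_roots_le_deg[OF finite_carrier, of ?d] card_Units by simp
    moreover have "q ^ (j - i) < q ^ f" using that q_gt_1 by (simp add: power_strict_increasing)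
    ultimately show False using gt by linarith
  qed
  then show ?thesis
    by (intro inj_onI) (metis lessThan_iff linorder_neqE_nat)
qed

text \<open>Evaluation at a generator \<open>g\<close> of the unit group embeds the Galois group
  into the set of roots of \<open>Irr K g\<close>, a polynomial of degree \<open>f\<close>.\<close>

lemma card_galois_group_le: "finite (carrier (galois_group L K)) \<and> card (carrier (galois_group L K)) \<le> f"
proof -
  obtain g where g: "g \<in> carrier L" and gen: "carrier L - {\<zero>} = {g [^] i | i::nat. i \<in> UNIV}"
    using finite_field_mult_group_has_gen[OF finite_carrier] by auto
  let ?E = "simple_extension K g"
  note K_ring = subfieldE(1)[OF subfield]
  have alg: "(algebraic over K) g"
    using finite_dimension_imp_algebraic[OF subfield carrier_is_subring _ g] finite_dimensionI[OF dim] by blast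
  have E: "subring ?E L" using simple_extension_is_subring[OF K_ring g] .
  \<comment> \<open>Every nonzero element of \<open>L\<close> is a power of \<open>g\<close>, so
    \<open>g\<close> also generates \<open>L\<close> over \<open>K\<close>. Its minimal polynomial
    therefore has the dimension of \<open>L\<close> as its degree.\<close>
  have "g [^] (i::nat) \<in> ?E" for i
    using simple_extension_mem[OF K_ring g] subringE(3,6)[OF E] by (induction i) auto
  then have "x \<in> ?E" if "x \<in> carrier L" for x
  proof (cases "x = \<zero>")
    case False
    then have "x \<in> {g [^] i | i::nat. i \<in> UNIV}" using that gen[symmetric] by simp
    then show ?thesis using \<open>\<And>i. g [^] (i::nat) \<in> ?E\<close> by auto
  qed (simp add: subringE(2)[OF E])
  then have EL: "?E = carrier L" using subringE(1)[OF E] by (intro equalityI subsetI) auto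
  let ?p = "Irr K g"
  have deg: "degree ?p = f"
    using dimension_simple_extension[OF subfield g alg] dim dimension_is_inj[OF subfield] EL by metis
  note Irr = IrrE[OF subfield g alg]
  have p_ne: "?p \<noteq> []" using deg degree_pos by auto
  have p: "?p \<in> carrier (poly_ring L)"
    using carrier_polynomial_shell[OF K_ring Irr(1)] .
  have pK: "set ?p \<subseteq> K"
    using Irr(1) by (auto simp: univ_poly_carrier[symmetric] polynomial_def)
  let ?ev = "\<lambda>\<sigma>. \<sigma> g"
  have "?ev ` carrier (galois_group L K) \<subseteq> set_mset (roots ?p)"
  proof (rule image_subsetI)
    fix \<sigma> assume s: "\<sigma> \<in> carrier (galois_group L K)"
    then have hom: "\<sigma> \<in> ring_hom L L" and fix_K: "\<And>x. x \<in> K \<Longrightarrow> \<sigma> x = x"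
      by (auto simp: carrier_galois_group ring_iso_def)
    interpret s: ring_hom_ring L L \<sigma> using hom by (intro ring_hom_ringI2 ring_axioms)
    \<comment> \<open>The coefficients lie in \<open>K\<close> and are fixed by \<sigma>, so
      \<sigma> commutes with evaluation of \<open>?p\<close> and permits no value at \<sigma> g but
      \<sigma> 0 = 0.\<close>
    have "map \<sigma> ?p = ?p" using fix_K pK by (intro map_idI) auto
    then have "eval ?p (\<sigma> g) = \<sigma> (eval ?p g)" using s.eval_hom[OF K_ring g Irr(1)] by simp
    then have "is_root ?p (\<sigma> g)" using Irr(4) g p_ne by (simp add: is_root_def)
    then show "\<sigma> g \<in># roots ?p" using roots_mem_iff_is_root[OF p] by simp
  qed
  \<comment> \<open>The degree bounds the roots counted with multiplicity, hence also the distinct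
    ones.\<close>
  moreover have "card (set_mset (roots ?p)) \<le> f"
  proof -
    have "card (set_mset (roots ?p)) \<le> size (roots ?p)"
      unfolding card_eq_sum size_multiset_overloaded_eq by (intro sum_mono) (simp add: Suc_le_eq)
    then show ?thesis using size_roots_le_degree[OF p] deg by simp
  qed
  moreover have inj: "inj_on ?ev (carrier (galois_group L K))"
  proof (rule inj_onI)
    fix \<sigma> \<tau> assume s: "\<sigma> \<in> carrier (galois_group L K)" "\<tau> \<in> carrier (galois_group L K)" "\<sigma> g = \<tau> g"
    have hom: "\<sigma> \<in> ring_hom L L" "\<tau> \<in> ring_hom L L"
      using s by (auto simp: carrier_galois_group ring_iso_def)
    interpret s: ring_hom_ring L L \<sigma> using hom(1) by (intro ring_hom_ringI2 ring_axioms)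
    interpret t: ring_hom_ring L L \<tau> using hom(2) by (intro ring_hom_ringI2 ring_axioms)
    have "\<sigma> x = \<tau> x" if "x \<in> carrier L" for x
    proof (cases "x = \<zero>")
      case False
      then have "x \<in> {g [^] i | i::nat. i \<in> UNIV}" using that gen[symmetric] by simp
      then obtain i :: nat where "x = g [^] i" by auto
      then show ?thesis using s(3) g by (simp add: s.hom_nat_pow t.hom_nat_pow)
    qed simp
    then show "\<sigma> = \<tau>" using s by (intro extensionalityI[of _ "carrier L"]) (auto simp: carrier_galois_group)
  qed
  ultimately show ?thesis
    by (metis (no_types, lifting) card_image card_mono finite_set_mset finite_subset inj_on_finite le_trans)
qed

text \<open>The powers of Frobenius with i < f are f distinct members of a set with at most f
  members.\<close>

lemma galois_group_eq: "carrier (galois_group L K) = (\<lambda>i. frobenius L (q ^ i)) ` {..<f}"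
  using card_galois_group_le frobenius_pow_in_galois_group card_image[OF inj_on_frobenius_pow]
  by (intro card_seteq[symmetric]) auto

lemma galois_group_cases:
  assumes "\<sigma> \<in> carrier (galois_group L K)"
  obtains i where "\<sigma> = frobenius L (q ^ i)"
  using assms galois_group_eq by auto

lemma galois_group_subset_Bij: "carrier (galois_group L K) \<subseteq> carrier (BijGroup (carrier L))"
  by (auto simp: carrier_galois_group BijGroup_def Bij_def ring_iso_def)

lemma compose_frobenius_pow: 
  "frobenius L (q ^ i) \<otimes>\<^bsub>BijGroup (carrier L)\<^esub> frobenius L (q ^ j) = frobenius L (q ^ (i + j))"
proof -
  have "frobenius L (q ^ i) \<in> Bij (carrier L)" for i
    using frobenius_pow_in_galois_group galois_group_subset_Bij by (auto simp: BijGroup_def)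
  then show ?thesis
    by (auto simp: BijGroup_def compose_def frobenius_def nat_pow_pow power_add mult.commute fun_eq_iff)
qed

lemma frobenius_0: "frobenius L (q ^ 0) = \<one>\<^bsub>BijGroup (carrier L)\<^esub>"
  by (auto simp: BijGroup_def frobenius_def fun_eq_iff)

lemma frobenius_period: "frobenius L (q ^ (f * i)) = \<one>\<^bsub>BijGroup (carrier L)\<^esub>"
  by (auto simp: BijGroup_def frobenius_def fun_eq_iff pow_iter_card)

text \<open>Composition adds the exponents i of the Frobenius powers \<open>q ^ i\<close>, so the
  inverse of the i-th one is the one with exponent \<open>f * i - i\<close>.\<close>

lemma subgroup_galois_group: "subgroup (carrier (galois_group L K)) (BijGroup (carrier L))"
proof -
  interpret B: Group.group "BijGroup (carrier L)" by (rule group_BijGroup)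
  show ?thesis
  proof (rule B.subgroupI)
    fix \<sigma> assume s: "\<sigma> \<in> carrier (galois_group L K)"
    obtain i where i: "\<sigma> = frobenius L (q ^ i)" using s galois_group_cases by blast
    have "(f * i - i) + i = f * i" using degree_pos by simp
    then have "frobenius L (q ^ (f * i - i)) \<otimes>\<^bsub>BijGroup (carrier L)\<^esub> \<sigma> = \<one>\<^bsub>BijGroup (carrier L)\<^esub>"
      using i compose_frobenius_pow frobenius_period by simp
    then have "inv\<^bsub>BijGroup (carrier L)\<^esub> \<sigma> = frobenius L (q ^ (f * i - i))"
      using s galois_group_subset_Bij frobenius_pow_in_galois_group by (intro B.inv_equality) blast+
    then show "inv\<^bsub>BijGroup (carrier L)\<^esub> \<sigma> \<in> carrier (galois_group L K)"
      using frobenius_pow_in_galois_group by simp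
    fix \<tau> assume "\<tau> \<in> carrier (galois_group L K)"
    then obtain j where "\<tau> = frobenius L (q ^ j)" using galois_group_cases by blast
    then show "\<sigma> \<otimes>\<^bsub>BijGroup (carrier L)\<^esub> \<tau> \<in> carrier (galois_group L K)"
      using i compose_frobenius_pow frobenius_pow_in_galois_group by simp
  qed (use galois_group_subset_Bij frobenius_pow_in_galois_group in blast)+
qed

lemma galois_group_is_group: "Group.group (galois_group L K)"
proof -
  have "galois_group L K = BijGroup (carrier L)\<lparr>carrier := carrier (galois_group L K)\<rparr>"
    by (simp add: galois_group_def)
  then show ?thesis
    using subgroup.subgroup_is_group[OF subgroup_galois_group group_BijGroup] by simp
qed

lemma galois_group_mult:
  "frobenius L (q ^ i) \<otimes>\<^bsub>galois_group L K\<^esub> frobenius L (q ^ j) = frobenius L (q ^ (i + j))"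
  using compose_frobenius_pow by (simp add: galois_group_def)

lemma galois_group_one: "\<one>\<^bsub>galois_group L K\<^esub> = frobenius L (q ^ 0)"
  using frobenius_0 by (simp add: galois_group_def)

lemma generate_frobenius: "generate (galois_group L K) {frobenius L q} = carrier (galois_group L K)"
proof
  interpret G: Group.group "galois_group L K" by (rule galois_group_is_group)
  show "generate (galois_group L K) {frobenius L q} \<subseteq> carrier (galois_group L K)"
    using frobenius_pow_in_galois_group[of 1] by (intro G.generate_incl) simp
  have "frobenius L (q ^ i) \<in> generate (galois_group L K) {frobenius L q}" for i
  proof (induction i)
    case 0
    then show ?case using generate.one[of "galois_group L K" "{frobenius L q}"] galois_group_one by simp
  next
    case (Suc i)
    then show ?case
      using generate.eng[OF Suc generate.incl[of "frobenius L q" "{frobenius L q}" "galois_group L K"]]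
        galois_group_mult[of i 1]
      by simp
  qed
  then show "carrier (galois_group L K) \<subseteq> generate (galois_group L K) {frobenius L q}"
    using galois_group_eq by auto
qed

section \<open>The norm as a power map\<close>

lemma galois_norm_eq:
  assumes "x \<in> carrier L"
  shows "galois_norm L K x = x [^] (\<Sum>i<f. q ^ i)"
proof -
  have "galois_norm L K x = (\<Otimes>i\<in>{..<f}. frobenius L (q ^ i) x)"
    unfolding galois_norm_def galois_group_eq
    by (rule finprod_reindex[OF _ inj_on_frobenius_pow]) (use assms in \<open>auto simp: frobenius_def\<close>)
  then show ?thesis using assms finprod_nat_pow[OF assms, of "\<lambda>i. q ^ i" "{..<f}"] by (simp add: frobenius_def)
qed

lemma Units_subfield: "Units (L\<lparr>carrier := K\<rparr>) = K - {\<zero>}"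
  using field.field_Units[OF subfield_iff(2)[OF subfield]] by simp

text \<open>By the geometric sum, the (q - 1)-st power of the norm is x^(q^f - 1) = 1. So the norm
  equals its own q-th power, and such elements make up \<open>K\<close>.\<close>

lemma galois_norm_closed:
  assumes "x \<in> Units L"
  shows "galois_norm L K x \<in> K - {\<zero>}"
proof -
  let ?S = "\<Sum>i<f. q ^ i"
  have x: "x \<in> carrier L" using assms by auto
  have "(x [^] ?S) [^] q = (x [^] ?S) [^] (q - 1) \<otimes> x [^] ?S"
    using q_gt_1 x nat_pow_Suc[of "x [^] ?S" "q - 1"] by simp
  also have "(x [^] ?S) [^] (q - 1) = \<one>"
    using x geometric_sum_nat[of q f] Units_pow_card[OF assms] by (simp add: nat_pow_pow)
  finally have "x [^] ?S \<in> K" using x by (simp add: subfield_iff_pow)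
  moreover have "x [^] ?S \<in> Units L" using assms Units_pow_closed by blast
  ultimately show ?thesis using galois_norm_eq[OF x] by (simp add: field_Units)
qed

lemma galois_norm_hom: "galois_norm L K \<in> hom (units_of L) (units_of (L\<lparr>carrier := K\<rparr>))"
  using galois_norm_closed Units_closed
  by (intro homI) (simp_all add: units_of_def Units_subfield galois_norm_eq nat_pow_distrib)

end

section \<open>Functoriality of \<open>H2q\<close>\<close>


lemma (in comm_group) nat_pow_hom: "(\<lambda>x. x [^] (n::nat)) \<in> hom G G"
  by (intro homI) (simp_all add: nat_pow_distrib)

lemma (in comm_group) subgroup_H2q_norms: "subgroup (H2q_norms q f G) G"
proof -
  interpret N: group_hom G G "\<lambda>x. x [^] (\<Sum>i<f. q ^ i)"
    by unfold_locales (rule nat_pow_hom)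
  show ?thesis unfolding H2q_norms_def by (rule N.img_is_subgroup)
qed

lemma (in comm_group) subgroup_kernel_pow: "subgroup (kernel G G (\<lambda>x. x [^] (n::nat))) G"
proof -
  interpret N: group_hom G G "\<lambda>x. x [^] n"
    by unfold_locales (rule nat_pow_hom)
  show ?thesis by (rule N.subgroup_kernel)
qed

lemma (in comm_group) comm_group_subgroup: "subgroup H G \<Longrightarrow> comm_group (G\<lparr>carrier := H\<rparr>)"
  using group.group_comm_groupI[OF subgroup.subgroup_is_group[OF _ group_axioms]] m_comm
  by (metis (no_types, lifting) monoid.select_convs(1) partial_object.select_convs(1) partial_object.update_convs(1)
      monoid.surjective subgroup.mem_carrier)

text \<open>The exponents multiply to (1 + q + ... + q^(f-1)) (q - 1) = q^f - 1. This makes the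
  quotient in \<open>H2q\<close> one by an actual subgroup.\<close>

lemma (in comm_group) H2q_norms_subset_kernel:
  assumes "\<And>x. x \<in> carrier G \<Longrightarrow> x [^] (q ^ f - 1) = \<one>"
  shows "H2q_norms q f G \<subseteq> kernel G G (\<lambda>x. x [^] (q - 1))"
  using assms geometric_sum_nat[of q f] by (auto simp: H2q_norms_def kernel_def nat_pow_pow)

lemma (in comm_group) H2q_normal:
  assumes "\<And>x. x \<in> carrier G \<Longrightarrow> x [^] (q ^ f - 1) = \<one>"
  shows "H2q_norms q f G \<lhd> G\<lparr>carrier := kernel G G (\<lambda>x. x [^] (q - 1))\<rparr>"
proof -
  interpret Z: comm_group "G\<lparr>carrier := kernel G G (\<lambda>x. x [^] (q - 1))\<rparr>"
    by (rule comm_group_subgroup[OF subgroup_kernel_pow])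
  show ?thesis
    using subgroup_incl[OF subgroup_H2q_norms subgroup_kernel_pow H2q_norms_subset_kernel[OF assms]]
    unfolding Z.normal_iff_subgroup by blast
qed

text \<open>Cosets depend on the multiplication alone, so classes taken in \<open>C\<close> are also
  the cosets in the subgroup from which \<open>H2q\<close> is formed.\<close>

lemma H2q_class_restrict: "H2q_class q f C x = H2q_norms q f C #>\<^bsub>C\<lparr>carrier := Z\<rparr>\<^esub> x"
  by (simp add: H2q_class_def r_coset_def)

lemma (in comm_group) H2q_class_hom:
  assumes "\<And>x. x \<in> carrier G \<Longrightarrow> x [^] (q ^ f - 1) = \<one>"
  shows "H2q_class q f G \<in> hom (G\<lparr>carrier := kernel G G (\<lambda>x. x [^] (q - 1))\<rparr>) (H2q q f G)"
  using normal.r_coset_hom_Mod[OF H2q_normal[OF assms]]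
  unfolding H2q_def H2q_class_restrict[of q f G _ "kernel G G (\<lambda>x. x [^] (q - 1))", abs_def]
  by simp

lemma carrier_H2q: "carrier (H2q q f C) = H2q_class q f C ` kernel C C (\<lambda>x. x [^]\<^bsub>C\<^esub> (q - 1))"
  by (simp add: H2q_def carrier_FactGroup H2q_class_restrict[of q f C _ "kernel C C (\<lambda>x. x [^]\<^bsub>C\<^esub> (q - 1))"])

lemma H2q_class_eq_norms_iff:
  assumes "comm_group D" "y \<in> carrier D"
  shows "H2q_class q f D y = H2q_norms q f D \<longleftrightarrow> y \<in> H2q_norms q f D"
  unfolding H2q_class_def
  using group.coset_join1[OF comm_group.axioms(2)] group.coset_join2[OF comm_group.axioms(2)] assms
    comm_group.subgroup_H2q_norms[OF assms(1)] subgroup.subset[OF comm_group.subgroup_H2q_norms[OF assms(1)]]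
  by metis

section \<open>The map induced by an isomorphism\<close>

context
  fixes C :: "('c, 'm) monoid_scheme" and D :: "('d, 'n) monoid_scheme" and \<phi> :: "'c \<Rightarrow> 'd" and q f :: nat
  assumes C: "comm_group C" and D: "comm_group D" and \<phi>: "\<phi> \<in> iso C D"
    and exponent: "\<And>x. x \<in> carrier C \<Longrightarrow> x [^]\<^bsub>C\<^esub> (q ^ f - 1) = \<one>\<^bsub>C\<^esub>"
begin

interpretation C: comm_group C by (rule C)
interpretation D: comm_group D by (rule D)
interpretation \<phi>: group_hom C D \<phi>
  using \<phi> by unfold_locales (simp add: iso_def)

lemma \<phi>_image: "\<phi> ` carrier C = carrier D" and \<phi>_inj: "inj_on \<phi> (carrier C)"
  using \<phi> by (auto simp: iso_def bij_betw_def)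

lemma exponent_D:
  assumes "y \<in> carrier D"
  shows "y [^]\<^bsub>D\<^esub> (q ^ f - 1) = \<one>\<^bsub>D\<^esub>"
proof -
  obtain x where x: "x \<in> carrier C" "y = \<phi> x" using assms \<phi>_image by blast
  then show ?thesis using exponent[of x] \<phi>.hom_nat_pow[of x "q ^ f - 1"] by simp
qed

abbreviation (input) "ZC \<equiv> kernel C C (\<lambda>x. x [^]\<^bsub>C\<^esub> (q - 1))"
abbreviation (input) "ZD \<equiv> kernel D D (\<lambda>x. x [^]\<^bsub>D\<^esub> (q - 1))"

lemma iso_image_kernel_pow: "\<phi> ` ZC = ZD"
proof (intro equalityI subsetI)
  fix y assume y: "y \<in> ZD"
  then obtain x where x: "x \<in> carrier C" "y = \<phi> x" using \<phi>_image by (auto simp: kernel_def)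
  have "\<phi> (x [^]\<^bsub>C\<^esub> (q - 1)) = \<phi> \<one>\<^bsub>C\<^esub>" using x y by (simp add: \<phi>.hom_nat_pow kernel_def)
  then have "x [^]\<^bsub>C\<^esub> (q - 1) = \<one>\<^bsub>C\<^esub>" using \<phi>_inj x by (meson C.nat_pow_closed C.one_closed inj_onD)
  then show "y \<in> \<phi> ` ZC" using x by (auto simp: kernel_def)
qed (auto simp: kernel_def \<phi>.hom_nat_pow[symmetric])

lemma iso_mem_H2q_norms_iff:
  assumes "x \<in> carrier C"
  shows "\<phi> x \<in> H2q_norms q f D \<longleftrightarrow> x \<in> H2q_norms q f C"
proof
  let ?S = "\<Sum>i<f. q ^ i"
  assume "\<phi> x \<in> H2q_norms q f D"
  then obtain z where z: "z \<in> carrier C" "\<phi> x = \<phi> z [^]\<^bsub>D\<^esub> ?S"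
    unfolding H2q_norms_def \<phi>_image[symmetric] by auto
  then have "\<phi> x = \<phi> (z [^]\<^bsub>C\<^esub> ?S)" by (simp add: \<phi>.hom_nat_pow)
  then have "x = z [^]\<^bsub>C\<^esub> ?S" using \<phi>_inj z assms by (meson C.nat_pow_closed inj_onD)
  then show "x \<in> H2q_norms q f C" using z by (auto simp: H2q_norms_def)
qed (auto simp: H2q_norms_def \<phi>.hom_nat_pow)

text \<open>This composite of \<phi> with the projection to classes is the homomorphism to which the
  first isomorphism theorem is applied below.\<close>

lemma group_hom_H2q_class_iso:
  "group_hom (C\<lparr>carrier := ZC\<rparr>) (H2q q f D) (\<lambda>x. H2q_class q f D (\<phi> x))"
proof (unfold group_hom_def group_hom_axioms_def, intro conjI)
  show "Group.group (C\<lparr>carrier := ZC\<rparr>)"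
    using subgroup.subgroup_is_group[OF C.subgroup_kernel_pow C.group_axioms] .
  show "Group.group (H2q q f D)"
    unfolding H2q_def using normal.factorgroup_is_group[OF D.H2q_normal] exponent_D by simp
  have "\<phi> \<in> hom (C\<lparr>carrier := ZC\<rparr>) (D\<lparr>carrier := ZD\<rparr>)"
    using iso_image_kernel_pow by (intro homI) (auto simp: kernel_def)
  then have "H2q_class q f D \<circ> \<phi> \<in> hom (C\<lparr>carrier := ZC\<rparr>) (H2q q f D)"
    using D.H2q_class_hom exponent_D hom_compose by blast
  then show "(\<lambda>x. H2q_class q f D (\<phi> x)) \<in> hom (C\<lparr>carrier := ZC\<rparr>) (H2q q f D)"
    by (simp add: comp_def)
qed

text \<open>An isomorphism preserves and reflects norms, so the class of \<phi> x is trivial exactly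
  when \<open>x\<close> is a norm in \<open>C\<close>.\<close>

lemma kernel_H2q_class_iso:
  "kernel (C\<lparr>carrier := ZC\<rparr>) (H2q q f D) (\<lambda>x. H2q_class q f D (\<phi> x)) = H2q_norms q f C"
proof -
  have "H2q_class q f D (\<phi> x) = \<one>\<^bsub>H2q q f D\<^esub> \<longleftrightarrow> x \<in> H2q_norms q f C" if "x \<in> carrier C" for x
    using H2q_class_eq_norms_iff[OF D, of "\<phi> x" q f] iso_mem_H2q_norms_iff[OF that] that
    by (simp add: H2q_def)
  then show ?thesis
    using C.H2q_norms_subset_kernel[OF exponent] by (auto simp: kernel_def)
qed

text \<open>The first isomorphism theorem: its map on the quotient is \<open>the_elem\<close> of the
  image of a coset, which is how \<open>H2q_map\<close> is defined.\<close>

lemma H2q_map_iso: "H2q_map q f D \<phi> \<in> iso (H2q q f C) (H2q q f D)"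
proof -
  interpret \<psi>: group_hom "C\<lparr>carrier := ZC\<rparr>" "H2q q f D" "\<lambda>x. H2q_class q f D (\<phi> x)"
    by (rule group_hom_H2q_class_iso)
  have "(\<lambda>x. H2q_class q f D (\<phi> x)) ` ZC = carrier (H2q q f D)"
    unfolding carrier_H2q iso_image_kernel_pow[symmetric] by (simp add: image_image)
  then show ?thesis
    using \<psi>.FactGroup_iso_set kernel_H2q_class_iso by (simp add: H2q_map_def H2q_def)
qed

text \<open>For \<open>the_elem\<close> to be meaningful the image of the coset must be a singleton.
  It is constant because norms map to the identity, and nonempty because the coset contains
  \<open>x\<close>.\<close>

lemma H2q_map_class:
  assumes x: "x \<in> ZC"
  shows "H2q_map q f D \<phi> (H2q_class q f C x) = H2q_class q f D (\<phi> x)"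
proof -
  interpret \<psi>: group_hom "C\<lparr>carrier := ZC\<rparr>" "H2q q f D" "\<lambda>x. H2q_class q f D (\<phi> x)"
    by (rule group_hom_H2q_class_iso)
  have "H2q_class q f D (\<phi> y) = H2q_class q f D (\<phi> x)" if "y \<in> H2q_class q f C x" for y
  proof -
    obtain n where n: "n \<in> H2q_norms q f C" "y = n \<otimes>\<^bsub>C\<^esub> x"
      using \<open>y \<in> _\<close> by (auto simp: H2q_class_def r_coset_def)
    then have k: "n \<in> kernel (C\<lparr>carrier := ZC\<rparr>) (H2q q f D) (\<lambda>x. H2q_class q f D (\<phi> x))"
      by (simp only: kernel_H2q_class_iso)
    then show ?thesis using n x \<psi>.hom_mult[of n x] \<psi>.hom_closed[of x] by (auto simp: kernel_def)
  qed
  moreover have "x \<in> H2q_class q f C x"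
    unfolding H2q_class_def using x
    by (intro C.rcos_self C.subgroup_H2q_norms) (simp add: kernel_def)
  ultimately have "(\<lambda>x. H2q_class q f D (\<phi> x)) ` H2q_class q f C x = {H2q_class q f D (\<phi> x)}"
    by blast
  then show ?thesis by (simp add: H2q_map_def)
qed

end

section \<open>Modules on which the Galois group acts by power maps\<close>

context finite_field_extension
begin

text \<open>Both modules of the theorem are instances. Since q^f - 1 kills \<open>C\<close>, the
  q^f-th power map is the identity, so the \<open>q ^ i\<close>-th power map is a bijection with
  inverse exponent \<open>q ^ (f * i - i)\<close>; it is a homomorphism as \<open>C\<close> is
  commutative.\<close>

lemma frobenius_group_module:
  fixes C :: "('c, 'd) monoid_scheme" and act :: "('a \<Rightarrow> 'a) \<Rightarrow> 'c \<Rightarrow> 'c"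
  assumes C: "comm_group C" and pow: "\<And>x. x \<in> carrier C \<Longrightarrow> x [^]\<^bsub>C\<^esub> (q ^ f - 1) = \<one>\<^bsub>C\<^esub>"
    and act: "\<And>i. act (frobenius L (q ^ i)) = (\<lambda>x\<in>carrier C. x [^]\<^bsub>C\<^esub> (q ^ i))"
  shows "group_module (galois_group L K) C act"
proof -
  interpret C: comm_group C by (rule C)
  interpret G: Group.group "galois_group L K" by (rule galois_group_is_group)
  have pow': "x [^]\<^bsub>C\<^esub> (q ^ (f * j)) = x" if "x \<in> carrier C" for x j
  proof -
    have "q ^ f = Suc (q ^ f - 1)" using q_gt_1 by simp
    then have "x [^]\<^bsub>C\<^esub> (q ^ f) = x" if "x \<in> carrier C" for x
      using C.nat_pow_Suc[of x "q ^ f - 1"] pow[OF that] that by simp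
    then show ?thesis using that
      by (induction j) (simp_all add: power_add C.nat_pow_pow[symmetric])
  qed
  have inverse: "(x [^]\<^bsub>C\<^esub> (q ^ i)) [^]\<^bsub>C\<^esub> (q ^ (f * i - i)) = x"
    and inverse': "(x [^]\<^bsub>C\<^esub> (q ^ (f * i - i))) [^]\<^bsub>C\<^esub> (q ^ i) = x"  if "x \<in> carrier C" for x i
  proof -
    have "i + (f * i - i) = f * i" using degree_pos by simp
    then show "(x [^]\<^bsub>C\<^esub> (q ^ i)) [^]\<^bsub>C\<^esub> (q ^ (f * i - i)) = x"
      "(x [^]\<^bsub>C\<^esub> (q ^ (f * i - i))) [^]\<^bsub>C\<^esub> (q ^ i) = x"
      using that pow' by (metis C.nat_pow_pow power_add add.commute)+
  qed
  have bij: "bij_betw (act (frobenius L (q ^ i))) (carrier C) (carrier C)" for i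
    by (rule bij_betw_byWitness[where f' = "\<lambda>x. x [^]\<^bsub>C\<^esub> (q ^ (f * i - i))"])
      (auto simp: act inverse inverse')
  have Bij: "act (frobenius L (q ^ i)) \<in> Bij (carrier C)" for i
    using bij by (simp add: Bij_def act)
  have mult: "act (frobenius L (q ^ (i + j)))
      = act (frobenius L (q ^ i)) \<otimes>\<^bsub>BijGroup (carrier C)\<^esub> act (frobenius L (q ^ j))" for i j
  proof -
    have "(\<lambda>x\<in>carrier C. x [^]\<^bsub>C\<^esub> (q ^ (i + j)))
        = compose (carrier C) (\<lambda>x\<in>carrier C. x [^]\<^bsub>C\<^esub> (q ^ i)) (\<lambda>x\<in>carrier C. x [^]\<^bsub>C\<^esub> (q ^ j))"
      by (rule ext) (simp add: compose_def C.nat_pow_pow power_add mult.commute)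
    then show ?thesis using Bij[of i] Bij[of j] unfolding act by (simp add: BijGroup_def)
  qed
  have "act \<in> hom (galois_group L K) (BijGroup (carrier C))"
  proof (rule homI)
    fix \<sigma> assume "\<sigma> \<in> carrier (galois_group L K)"
    then obtain i where i: "\<sigma> = frobenius L (q ^ i)" by (rule galois_group_cases)
    show "act \<sigma> \<in> carrier (BijGroup (carrier C))" using Bij[of i] by (simp only: i BijGroup_def partial_object.simps)
    fix \<tau> assume "\<tau> \<in> carrier (galois_group L K)"
    then obtain j where j: "\<tau> = frobenius L (q ^ j)" by (rule galois_group_cases)
    show "act (\<sigma> \<otimes>\<^bsub>galois_group L K\<^esub> \<tau>) = act \<sigma> \<otimes>\<^bsub>BijGroup (carrier C)\<^esub> act \<tau>"
      by (simp only: i j galois_group_mult mult)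
  qed
  moreover have "act \<sigma> \<in> hom C C" if \<sigma>: "\<sigma> \<in> carrier (galois_group L K)" for \<sigma>
  proof -
    obtain i where i: "\<sigma> = frobenius L (q ^ i)" using \<sigma> by (rule galois_group_cases)
    show ?thesis unfolding i act by (intro homI) (simp_all add: C.nat_pow_distrib)
  qed
  ultimately show ?thesis
    using group_BijGroup
    by (intro group_module.intro group_action.intro group_hom.intro group_hom_axioms.intro
        group_module_axioms.intro C G.group_axioms)
qed

end

section \<open>Power classes and roots of unity\<close>


context finite_field_extension
begin

lemma Units_generator:
  obtains g where "g \<in> Units L" "Units L = range (\<lambda>i::nat. g [^] i)"
    "\<And>n::nat. g [^] n = \<one> \<longleftrightarrow> q ^ f - 1 dvd n"
proof -
  interpret U: comm_group "units_of L" by (rule units_comm_group)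
  obtain g where g: "g \<in> Units L" and "Units L = {g [^] i | i::nat. i \<in> UNIV}"
    using finite_field_mult_group_has_gen[OF finite_carrier] by (auto simp: field_Units)
  then have gen: "Units L = range (\<lambda>i::nat. g [^] i)" by auto
  have gU: "g \<in> carrier (units_of L)" and finU: "finite (carrier (units_of L))"
    using g finite_carrier by (simp_all add: units_of_carrier field_Units)
  have "generate (units_of L) {g} = Units L"
    using U.generate_pow_on_finite_carrier[OF finU gU] gen by (auto simp: units_of_pow[OF g])
  then have "U.ord g = q ^ f - 1"
    using U.generate_pow_card[OF gU] card_Units by simp
  then have "g [^] n = \<one> \<longleftrightarrow> q ^ f - 1 dvd n" for n :: nat
    using U.pow_eq_id[OF gU, of n] by (simp add: units_of_pow[OF g] units_of_one)
  then show thesis using that g gen by blast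
qed

text \<open>In a cyclic group of order a b the kernel of the a-th power map is the image of the
  b-th: g^(i a) = 1 forces a b to divide a i, hence b to divide i. It is used with \<open>e\<close>
  in either role.\<close>

lemma pow_eq_one_iff_is_pow:
  assumes ab: "a * b = q ^ f - 1" and x: "x \<in> Units L"
  shows "x [^] a = \<one> \<longleftrightarrow> (\<exists>y\<in>Units L. x = y [^] b)"
proof
  assume *: "x [^] a = \<one>"
  obtain g where g: "g \<in> Units L" "Units L = range (\<lambda>i::nat. g [^] i)"
    "\<And>n::nat. g [^] n = \<one> \<longleftrightarrow> q ^ f - 1 dvd n" using Units_generator by blast
  obtain i :: nat where i: "x = g [^] i" using x g(2) by auto
  have "a * b dvd a * i"
    using * i g(1,3) by (simp add: nat_pow_pow Units_closed ab mult.commute)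
  moreover have "a \<noteq> 0" using ab one_less_power[OF q_gt_1 degree_pos] by (intro notI) simp
  ultimately obtain k where "i = b * k" by auto
  then have "x = (g [^] k) [^] b" using i g(1) by (simp add: nat_pow_pow Units_closed mult.commute)
  then show "\<exists>y\<in>Units L. x = y [^] b" using Units_pow_closed g(1) by blast
next
  assume "\<exists>y\<in>Units L. x = y [^] b"
  then show "x [^] a = \<one>"
    using Units_pow_card ab by (auto simp: nat_pow_pow Units_closed mult.commute)
qed

text \<open>The computation behind the theorem: if \<open>\<xi> = g\<^sup>i\<close> and \<open>\<alpha> = g\<^sup>j\<close>, where \<open>i\<close> is chosen
  large in its residue class, then \<open>i k = j e + c (q\<^sup>f - 1)\<close> with a natural number \<open>c\<close>, and
  \<open>y = g\<^bsup>c n\<^esup>\<close> is the required root of unity.\<close>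
lemma pow_eq_pow_witness:
  fixes s k e n :: nat
  assumes sk: "s * k = q ^ f - 1" and en: "e * n = q ^ f - 1"
    and x: "\<xi> \<in> Units L" and a: "\<alpha> \<in> Units L" and eq: "\<xi> [^] k = \<alpha> [^] e"
  obtains y where "y \<in> Units L" "y [^] e = \<one>" "\<xi> [^] n = y [^] s \<otimes> \<alpha> [^] s"
proof -
  obtain g where g: "g \<in> Units L" "Units L = range (\<lambda>i::nat. g [^] i)"
    "\<And>n::nat. g [^] n = \<one> \<longleftrightarrow> q ^ f - 1 dvd n" using Units_generator by blast
  define M where "M = q ^ f - 1"
  have M: "M > 0" using one_less_power[OF q_gt_1 degree_pos] by (simp add: M_def)
  then have k: "k > 0" using sk by (intro gr0I) (simp add: M_def)
  have gc: "g \<in> carrier L" using g(1) by auto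
  obtain i' j :: nat where i': "\<xi> = g [^] i'" and j: "\<alpha> = g [^] j" using x a g(2) by auto
  \<comment> \<open>The added multiple of \<open>M\<close> leaves the power of \<open>g\<close>
    unchanged and ensures \<open>j * e \<le> i * k\<close>, so the difference of exponents below is
    not truncated.\<close>
  define i where "i = i' + j * e * M"
  have "g [^] (j * e * M) = \<one>" using g(3) by (simp add: M_def)
  then have i: "\<xi> = g [^] i" using i' gc nat_pow_mult[OF gc, of i' "j * e * M"] by (simp add: i_def)
  have "j * e * 1 \<le> j * e * (M * k)" using M k by (intro mult_le_mono2) (simp add: Suc_le_eq)
  moreover have "i * k = i' * k + j * e * (M * k)" by (simp add: i_def algebra_simps)
  ultimately have le: "j * e \<le> i * k" by linarith
  have "g [^] (i * k) = g [^] (j * e)" using eq i j gc by (simp add: nat_pow_pow)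
  then have "g [^] (i * k - j * e) \<otimes> g [^] (j * e) = \<one> \<otimes> g [^] (j * e)"
    using le gc nat_pow_mult[OF gc, of "i * k - j * e" "j * e"] by simp
  moreover have "g [^] (j * e) \<in> Units L" using g(1) Units_pow_closed by blast
  ultimately have "g [^] (i * k - j * e) = \<one>"
    using gc m_rcancel[of "g [^] (j * e)" "g [^] (i * k - j * e)" \<one>] by (simp add: field_Units)
  then obtain c where "i * k - j * e = M * c" using g(3) by (auto simp: M_def)
  then have ik: "i * k = j * e + M * c" using le by simp
  \<comment> \<open>Multiplying the relation for \<open>i * k\<close> by \<open>n\<close> and
    replacing both \<open>e * n\<close> and \<open>M\<close> by \<open>s * k\<close> gives a common
    factor \<open>k\<close>, which is positive and can be cancelled.\<close>
  have "i * n * k = (i * k) * n" by simp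
  also have "\<dots> = j * (e * n) + M * c * n" by (simp add: ik algebra_simps)
  also have "\<dots> = (j * s + s * c * n) * k"
    unfolding en sk[symmetric] M_def by (simp add: algebra_simps)
  finally have "i * n = j * s + s * c * n" using k by simp
  then have "\<xi> [^] n = (g [^] (c * n)) [^] s \<otimes> \<alpha> [^] s"
    using i j gc by (simp add: nat_pow_pow nat_pow_mult algebra_simps)
  moreover have "(g [^] (c * n)) [^] e = \<one>"
    using gc g(3) en by (simp add: nat_pow_pow mult.assoc) (simp add: mult.commute[of n e])
  ultimately show thesis using that Units_pow_closed g(1) by blast
qed

end

section \<open>The two modules and the isomorphism between them\<close>

locale finite_field_extension_roots = finite_field_extension +
  fixes e :: nat
  assumes e_cong: "[q ^ f = 1] (mod e)"
begin

abbreviation cofactor :: nat where "cofactor \<equiv> (q ^ f - 1) div e"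

lemma e_mult_cofactor: "e * cofactor = q ^ f - 1" "cofactor * e = q ^ f - 1"
proof -
  \<comment> \<open>This allows the congruence to be read as divisibility of the natural number
    \<open>q ^ f - 1\<close>.\<close>
  have "q ^ f \<ge> 1" using q_gt_1 by simp
  then have "e dvd q ^ f - 1"
    using e_cong by (metis cong_altdef_nat)
  then show "e * cofactor = q ^ f - 1" "cofactor * e = q ^ f - 1" by simp_all
qed

lemma Units_pow_e_cofactor: "x \<in> Units L \<Longrightarrow> x [^] (e * cofactor) = \<one>"
  using Units_pow_card by (simp only: e_mult_cofactor(1))

sublocale U: comm_group "units_of L"
  by (rule units_comm_group)

lemma carrier_units_of: "carrier (units_of L) = Units L"
  by (rule units_of_carrier)

lemma unit_powers_iff: "x \<in> unit_powers L e \<longleftrightarrow> x \<in> Units L \<and> x [^] cofactor = \<one>"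
  using pow_eq_one_iff_is_pow[OF e_mult_cofactor(2)] Units_pow_closed
  by (auto simp: unit_powers_def carrier_units_of)

lemma subgroup_unity_roots: "subgroup (carrier (unity_roots L e)) (units_of L)"
proof -
  have "carrier (unity_roots L e) = kernel (units_of L) (units_of L) (\<lambda>x. x [^]\<^bsub>units_of L\<^esub> e)"
    by (auto simp: unity_roots_def kernel_def carrier_units_of units_of_one units_of_pow)
  then show ?thesis using U.subgroup_kernel_pow by simp
qed

lemma unity_roots_eq: "unity_roots L e = units_of L\<lparr>carrier := carrier (unity_roots L e)\<rparr>"
  by (simp add: unity_roots_def)

lemma comm_group_unity_roots: "comm_group (unity_roots L e)"
  using U.comm_group_subgroup[OF subgroup_unity_roots] unity_roots_eq by simp

lemma carrier_unity_roots: "carrier (unity_roots L e) = {x \<in> Units L. x [^] e = \<one>}"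
  by (simp add: unity_roots_def carrier_units_of)

lemma mult_unity_roots: "x \<otimes>\<^bsub>unity_roots L e\<^esub> y = x \<otimes> y"
  and one_unity_roots: "\<one>\<^bsub>unity_roots L e\<^esub> = \<one>"
  by (simp_all add: unity_roots_def units_of_mult units_of_one)

lemma pow_unity_roots: "x \<in> Units L \<Longrightarrow> x [^]\<^bsub>unity_roots L e\<^esub> (n::nat) = x [^] n"
  using U.nat_pow_consistent[of x n "carrier (unity_roots L e)"]
  by (simp add: unity_roots_eq[symmetric] units_of_pow)

lemma group_hom_cofactor: "group_hom (units_of L) (unity_roots L e) (\<lambda>x. x [^] cofactor)"
proof (unfold group_hom_def group_hom_axioms_def, intro conjI homI)
  show "Group.group (units_of L)" "Group.group (unity_roots L e)"
    using comm_group.axioms(2) comm_group_unity_roots U.group_axioms by auto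
  show "x [^] cofactor \<in> carrier (unity_roots L e)" if "x \<in> carrier (units_of L)" for x
    using that Units_pow_closed Units_pow_card[of x] e_mult_cofactor(2)
    by (simp add: carrier_unity_roots carrier_units_of nat_pow_pow Units_closed)
qed (simp add: carrier_units_of units_of_mult mult_unity_roots nat_pow_distrib Units_closed)

lemma kernel_cofactor: "kernel (units_of L) (unity_roots L e) (\<lambda>x. x [^] cofactor) = unit_powers L e"
  by (auto simp: kernel_def carrier_units_of one_unity_roots unit_powers_iff)

lemma subgroup_unit_powers: "subgroup (unit_powers L e) (units_of L)"
  using group_hom.subgroup_kernel[OF group_hom_cofactor] kernel_cofactor by simp

lemma normal_unit_powers: "unit_powers L e \<lhd> units_of L"
  using subgroup_unit_powers U.normal_iff_subgroup by blast

lemma comm_group_power_classes: "comm_group (power_classes L e)"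
  unfolding power_classes_def by (rule U.abelian_FactGroup[OF subgroup_unit_powers])

lemma carrier_power_classes: "carrier (power_classes L e) = class_mod_powers L e ` Units L"
  by (simp add: power_classes_def carrier_FactGroup class_mod_powers_def[abs_def] carrier_units_of)

lemma one_power_classes: "\<one>\<^bsub>power_classes L e\<^esub> = unit_powers L e"
  by (simp add: power_classes_def)

lemma pow_power_classes:
  assumes "x \<in> Units L"
  shows "class_mod_powers L e x [^]\<^bsub>power_classes L e\<^esub> (n::nat) = class_mod_powers L e (x [^] n)"
  using normal.FactGroup_pow[OF normal_unit_powers, of x n] assms
  by (simp add: power_classes_def class_mod_powers_def carrier_units_of units_of_pow)

lemma class_mod_powers_trivial: "x \<in> unit_powers L e \<Longrightarrow> class_mod_powers L e x = unit_powers L e"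
  using U.coset_join2[OF _ subgroup_unit_powers, of x]
  by (simp add: class_mod_powers_def carrier_units_of unit_powers_iff)

lemma unity_roots_exponent:
  assumes "x \<in> carrier (unity_roots L e)"
  shows "x [^]\<^bsub>unity_roots L e\<^esub> (q ^ f - 1) = \<one>\<^bsub>unity_roots L e\<^esub>"
  using assms Units_pow_card by (simp add: carrier_unity_roots pow_unity_roots one_unity_roots)

lemma power_classes_exponent:
  assumes "S \<in> carrier (power_classes L e)"
  shows "S [^]\<^bsub>power_classes L e\<^esub> (q ^ f - 1) = \<one>\<^bsub>power_classes L e\<^esub>"
  using assms Units_pow_card class_mod_powers_trivial[of \<one>]
  by (auto simp: carrier_power_classes pow_power_classes one_power_classes unit_powers_iff)

lemma mem_class_mod_powers: "y \<in> class_mod_powers L e x \<longleftrightarrow> (\<exists>r\<in>Units L. y = r [^] e \<otimes> x)"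
  by (auto simp: class_mod_powers_def r_coset_def unit_powers_def carrier_units_of units_of_mult)

text \<open>The image of a coset is a whole coset because the \<open>q ^ i\<close>-th power map is
  onto the units, hence onto the \<open>e\<close>-th powers among them.\<close>

lemma frobenius_image_class:
  assumes x: "x \<in> Units L"
  shows "frobenius L (q ^ i) ` class_mod_powers L e x = class_mod_powers L e (x [^] (q ^ i))"
proof (intro equalityI subsetI)
  fix y assume "y \<in> frobenius L (q ^ i) ` class_mod_powers L e x"
  then obtain r where r: "r \<in> Units L" "y = (r [^] e \<otimes> x) [^] (q ^ i)"
    using x by (auto simp: mem_class_mod_powers frobenius_def Units_closed)
  then have "y = (r [^] (q ^ i)) [^] e \<otimes> x [^] (q ^ i)"
    using x by (simp add: nat_pow_distrib nat_pow_pow mult.commute Units_closed)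
  then show "y \<in> class_mod_powers L e (x [^] (q ^ i))"
    using r(1) Units_pow_closed by (auto simp: mem_class_mod_powers)
next
  fix y assume "y \<in> class_mod_powers L e (x [^] (q ^ i))"
  then obtain r where r: "r \<in> Units L" "y = r [^] e \<otimes> x [^] (q ^ i)"
    by (auto simp: mem_class_mod_powers)
  \<comment> \<open>This is the unit whose \<open>q ^ i\<close>-th power is
    \<open>r\<close>.\<close>
  define s where "s = r [^] (q ^ (f * i - i))"
  have s: "s \<in> Units L" using r(1) Units_pow_closed by (simp add: s_def)
  have "s [^] (q ^ i) = (r [^] (q ^ i)) [^] (q ^ (f * i - i))"
    using r(1) by (simp add: s_def nat_pow_pow mult.commute Units_closed)
  then have "r = s [^] (q ^ i)" using pow_pow_inverse r(1) by (simp add: Units_closed)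
  then have "y = frobenius L (q ^ i) (s [^] e \<otimes> x)"
    using r(2) s x by (simp add: frobenius_def nat_pow_distrib nat_pow_pow mult.commute Units_closed)
  moreover have "s [^] e \<otimes> x \<in> class_mod_powers L e x"
    using s by (auto simp: mem_class_mod_powers)
  ultimately show "y \<in> frobenius L (q ^ i) ` class_mod_powers L e x" by blast
qed

lemma power_classes_act_frobenius:
  "power_classes_act L e (frobenius L (q ^ i))
     = (\<lambda>S\<in>carrier (power_classes L e). S [^]\<^bsub>power_classes L e\<^esub> (q ^ i))"
  unfolding power_classes_act_def
  by (rule restrict_ext) (clarsimp simp: carrier_power_classes frobenius_image_class pow_power_classes)

lemma unity_roots_act_frobenius:
  "unity_roots_act L e (frobenius L (q ^ i))
     = (\<lambda>x\<in>carrier (unity_roots L e). x [^]\<^bsub>unity_roots L e\<^esub> (q ^ i))"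
  unfolding unity_roots_act_def
  by (rule restrict_ext) (auto simp: carrier_unity_roots pow_unity_roots frobenius_def Units_closed)

lemma group_module_power_classes:
  "group_module (galois_group L K) (power_classes L e) (power_classes_act L e)"
  using frobenius_group_module[OF comm_group_power_classes power_classes_exponent power_classes_act_frobenius] .

lemma group_module_unity_roots:
  "group_module (galois_group L K) (unity_roots L e) (unity_roots_act L e)"
  using frobenius_group_module[OF comm_group_unity_roots unity_roots_exponent unity_roots_act_frobenius] .

text \<open>Since \<open>e * cofactor\<close> is the order of the unit group, \<open>e\<close>-th
  powers become 1, so the image of the coset is the singleton that \<open>the_elem\<close>
  needs.\<close>

lemma power_classes_to_roots_class:
  assumes "\<xi> \<in> Units L"
  shows "power_classes_to_roots L (q ^ f) e (class_mod_powers L e \<xi>) = \<xi> [^] cofactor"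
proof -
  have "y [^] cofactor = \<xi> [^] cofactor" if "y \<in> class_mod_powers L e \<xi>" for y
    using that assms Units_pow_e_cofactor
    by (auto simp: mem_class_mod_powers nat_pow_distrib nat_pow_pow Units_closed)
  moreover have "\<xi> \<in> class_mod_powers L e \<xi>"
    using assms by (auto simp: mem_class_mod_powers Units_closed intro!: bexI[of _ \<one>])
  ultimately have "(\<lambda>x. x [^] cofactor) ` class_mod_powers L e \<xi> = {\<xi> [^] cofactor}" by blast
  then show ?thesis by (simp add: power_classes_to_roots_def)
qed

text \<open>The first isomorphism theorem for x \<mapsto> x^\<open>cofactor\<close>. Surjectivity
  holds because every \<open>e\<close>-th root of unity is a \<open>cofactor\<close>-th
  power.\<close>

lemma power_classes_to_roots_iso:
  "power_classes_to_roots L (q ^ f) e \<in> iso (power_classes L e) (unity_roots L e)"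
proof -
  interpret N: group_hom "units_of L" "unity_roots L e" "\<lambda>x. x [^] cofactor"
    by (rule group_hom_cofactor)
  have "carrier (unity_roots L e) \<subseteq> (\<lambda>x. x [^] cofactor) ` Units L"
    using pow_eq_one_iff_is_pow[OF e_mult_cofactor(1)] by (auto simp: carrier_unity_roots)
  then have "(\<lambda>x. x [^] cofactor) ` carrier (units_of L) = carrier (unity_roots L e)"
    using N.hom_closed by (auto simp: carrier_units_of)
  then show ?thesis
    unfolding power_classes_to_roots_def power_classes_def kernel_cofactor[symmetric]
    by (rule N.FactGroup_iso_set)
qed

text \<open>Equivariance is automatic: every automorphism acts on both sides by the same power, and
  homomorphisms commute with powers.\<close>

lemma power_classes_to_roots_module_iso:
  "power_classes_to_roots L (q ^ f) e
     \<in> group_module_iso (galois_group L K) (power_classes L e) (power_classes_act L e)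
         (unity_roots L e) (unity_roots_act L e)"
proof -
  let ?\<phi> = "power_classes_to_roots L (q ^ f) e"
  interpret C: comm_group "power_classes L e" by (rule comm_group_power_classes)
  interpret D: comm_group "unity_roots L e" by (rule comm_group_unity_roots)
  interpret \<phi>: group_hom "power_classes L e" "unity_roots L e" ?\<phi>
    using power_classes_to_roots_iso by unfold_locales (simp add: iso_def)
  have "?\<phi> (power_classes_act L e \<sigma> S) = unity_roots_act L e \<sigma> (?\<phi> S)"
    if "\<sigma> \<in> carrier (galois_group L K)" "S \<in> carrier (power_classes L e)" for \<sigma> S
    using that
    by (auto simp: galois_group_eq power_classes_act_frobenius unity_roots_act_frobenius \<phi>.hom_nat_pow)
  then show ?thesis using power_classes_to_roots_iso by (simp add: group_module_iso_def)
qed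

text \<open>The last claim reduces to \<open>pow_eq_pow_witness\<close>: the two representatives
  differ by y^s with y^e = 1, which is a norm inside the module of roots of unity.\<close>

lemma H2q_class_norm:
  assumes \<xi>: "\<xi> \<in> Units L" and \<alpha>: "\<alpha> \<in> Units L" and eq: "\<xi> [^] (q - 1) = \<alpha> [^] e"
  shows "class_mod_powers L e \<xi>
      \<in> kernel (power_classes L e) (power_classes L e) (\<lambda>x. x [^]\<^bsub>power_classes L e\<^esub> (q - 1))"
    and "galois_norm L K \<alpha>
      \<in> kernel (unity_roots L e) (unity_roots L e) (\<lambda>x. x [^]\<^bsub>unity_roots L e\<^esub> (q - 1))"
    and "H2q_class q f (unity_roots L e) (\<xi> [^] cofactor)
      = H2q_class q f (unity_roots L e) (galois_norm L K \<alpha>)"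
proof -
  interpret D: comm_group "unity_roots L e" by (rule comm_group_unity_roots)
  let ?s = "\<Sum>i<f. q ^ i"
  have "\<alpha> [^] e \<in> unit_powers L e" using \<alpha> by (auto simp: unit_powers_def carrier_units_of)
  then show "class_mod_powers L e \<xi>
      \<in> kernel (power_classes L e) (power_classes L e) (\<lambda>x. x [^]\<^bsub>power_classes L e\<^esub> (q - 1))"
    using \<xi> eq class_mod_powers_trivial
    by (simp add: kernel_def carrier_power_classes pow_power_classes one_power_classes)
  have norm: "galois_norm L K \<alpha> = \<alpha> [^] ?s" using \<alpha> by (simp add: galois_norm_eq Units_closed)
  have unit: "\<alpha> [^] ?s \<in> Units L" using \<alpha> Units_pow_closed by blast
  \<comment> \<open>The norm of \<alpha> is an \<open>e\<close>-th root of unity, since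
    (\<alpha>^e)^s = \<xi>^((q-1) s) = \<xi>^(q^f - 1) = 1.\<close>
  have "(\<alpha> [^] ?s) [^] e = (\<alpha> [^] e) [^] ?s"
    using \<alpha> by (simp add: nat_pow_pow Units_closed mult.commute)
  also have "\<dots> = \<xi> [^] (?s * (q - 1))"
    using \<xi> by (simp add: eq[symmetric] nat_pow_pow Units_closed mult.commute)
  also have "\<dots> = \<one>" using \<xi> Units_pow_card by (simp only: geometric_sum_nat)
  finally have mem: "\<alpha> [^] ?s \<in> carrier (unity_roots L e)" using unit by (simp add: carrier_unity_roots)
  have "(\<alpha> [^] ?s) [^] (q - 1) = \<one>"
    using \<alpha> Units_pow_card geometric_sum_nat[of q f] by (simp add: nat_pow_pow Units_closed)
  then show "galois_norm L K \<alpha>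
      \<in> kernel (unity_roots L e) (unity_roots L e) (\<lambda>x. x [^]\<^bsub>unity_roots L e\<^esub> (q - 1))"
    using mem unit by (simp add: norm kernel_def pow_unity_roots one_unity_roots)
  obtain y where y: "y \<in> Units L" "y [^] e = \<one>" "\<xi> [^] cofactor = y [^] ?s \<otimes> \<alpha> [^] ?s"
    using pow_eq_pow_witness[OF geometric_sum_nat e_mult_cofactor(1) \<xi> \<alpha> eq] .
  \<comment> \<open>It matters that \<open>y\<close> itself is an \<open>e\<close>-th root of unity:
    only then is y^s among the norms of \<open>unity_roots L e\<close>.\<close>
  have "y [^] ?s = y [^]\<^bsub>unity_roots L e\<^esub> ?s" "y \<in> carrier (unity_roots L e)"
    using y by (simp_all add: pow_unity_roots carrier_unity_roots)
  then have "y [^] ?s \<in> H2q_norms q f (unity_roots L e)" by (auto simp: H2q_norms_def)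
  then have "\<xi> [^] cofactor \<in> H2q_class q f (unity_roots L e) (\<alpha> [^] ?s)"
    using y(3) by (auto simp: H2q_class_def r_coset_def mult_unity_roots)
  then show "H2q_class q f (unity_roots L e) (\<xi> [^] cofactor)
      = H2q_class q f (unity_roots L e) (galois_norm L K \<alpha>)"
    unfolding norm H2q_class_def using D.repr_independence mem D.subgroup_H2q_norms by metis
qed

end

theorem proposition2p2p1:
  fixes L :: "('a, 'b) ring_scheme" and K :: "'a set" and q f e :: nat
  assumes "field L" and "subfield K L"
    and "finite K" and "card K = q"
    and "f > 0" and "ring.dimension L f K (carrier L)"
    and "e > 0" and "[q ^ f = 1] (mod e)"
  shows
    "frobenius L q \<in> carrier (galois_group L K) \<and>
     generate (galois_group L K) {frobenius L q} = carrier (galois_group L K) \<and>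
     galois_norm L K \<in> hom (units_of L) (units_of (L\<lparr>carrier := K\<rparr>)) \<and>
     group_module (galois_group L K) (power_classes L e) (power_classes_act L e) \<and>
         (\<forall>S\<in>carrier (power_classes L e).
            power_classes_act L e (frobenius L q) S = S [^]\<^bsub>power_classes L e\<^esub> q) \<and>
     group_module (galois_group L K) (unity_roots L e) (unity_roots_act L e) \<and>
         (\<forall>x\<in>carrier (unity_roots L e).
            unity_roots_act L e (frobenius L q) x = x [^]\<^bsub>unity_roots L e\<^esub> q) \<and>
     power_classes_to_roots L (q ^ f) e
           \<in> group_module_iso (galois_group L K)
               (power_classes L e) (power_classes_act L e)
               (unity_roots L e) (unity_roots_act L e) \<and>
     (\<forall>\<xi>\<in>carrier (units_of L).
           power_classes_to_roots L (q ^ f) e (class_mod_powers L e \<xi>) = \<xi> [^]\<^bsub>L\<^esub> ((q ^ f - 1) div e)) \<and>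
     H2q_map q f (unity_roots L e) (power_classes_to_roots L (q ^ f) e)
           \<in> iso (H2q q f (power_classes L e)) (H2q q f (unity_roots L e)) \<and>
     (\<forall>\<xi>\<in>carrier (units_of L). \<xi> [^]\<^bsub>L\<^esub> (q - 1) \<in> unit_powers L e \<longrightarrow>
           (\<forall>\<alpha>\<in>carrier (units_of L). \<xi> [^]\<^bsub>L\<^esub> (q - 1) = \<alpha> [^]\<^bsub>L\<^esub> e \<longrightarrow>
              H2q_class q f (power_classes L e) (class_mod_powers L e \<xi>)
                \<in> carrier (H2q q f (power_classes L e)) \<and>
              galois_norm L K \<alpha> \<in> kernel (unity_roots L e) (unity_roots L e)
                                   (\<lambda>x. x [^]\<^bsub>unity_roots L e\<^esub> (q - 1)) \<and>
              H2q_map q f (unity_roots L e) (power_classes_to_roots L (q ^ f) e)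
                  (H2q_class q f (power_classes L e) (class_mod_powers L e \<xi>))
                = H2q_class q f (unity_roots L e) (galois_norm L K \<alpha>)))"
proof -
  interpret L: field L by (rule assms(1))
  interpret finite_field_extension_roots L K q f e
    by (intro finite_field_extension_roots.intro finite_field_extension.intro
        finite_field_extension_axioms.intro finite_field_extension_roots_axioms.intro assms)
  let ?C = "power_classes L e" and ?D = "unity_roots L e"
  let ?\<phi> = "power_classes_to_roots L (q ^ f) e"
  \<comment> \<open>The induced map sends [\<xi>] to the class of \<xi>^\<open>cofactor\<close>, and
    \<open>H2q_class_norm\<close> identifies that class with the class of the norm of
    \<alpha>.\<close>
  have main: "H2q_class q f ?C (class_mod_powers L e \<xi>) \<in> carrier (H2q q f ?C)"
    "galois_norm L K \<alpha> \<in> kernel ?D ?D (\<lambda>x. x [^]\<^bsub>?D\<^esub> (q - 1))"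
    "H2q_map q f ?D ?\<phi> (H2q_class q f ?C (class_mod_powers L e \<xi>)) = H2q_class q f ?D (galois_norm L K \<alpha>)"
    if "\<xi> \<in> Units L" "\<alpha> \<in> Units L" "\<xi> [^]\<^bsub>L\<^esub> (q - 1) = \<alpha> [^]\<^bsub>L\<^esub> e" for \<xi> \<alpha>
    using H2q_class_norm[OF that] that(1) power_classes_to_roots_class[OF that(1)]
      H2q_map_class[OF comm_group_power_classes comm_group_unity_roots power_classes_to_roots_iso
        power_classes_exponent, of "class_mod_powers L e \<xi>"]
    by (simp_all add: carrier_H2q)
  show ?thesis
    unfolding carrier_units_of
  proof (intro conjI ballI impI)
    show "frobenius L q \<in> carrier (galois_group L K)"
      using frobenius_pow_in_galois_group[of 1] by simp
    show "power_classes_act L e (frobenius L q) S = S [^]\<^bsub>?C\<^esub> q" if "S \<in> carrier ?C" for S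
      using power_classes_act_frobenius[of 1] that by simp
    show "unity_roots_act L e (frobenius L q) x = x [^]\<^bsub>?D\<^esub> q" if "x \<in> carrier ?D" for x
      using unity_roots_act_frobenius[of 1] that by simp
    show "H2q_map q f ?D ?\<phi> \<in> iso (H2q q f ?C) (H2q q f ?D)"
      using H2q_map_iso[OF comm_group_power_classes comm_group_unity_roots power_classes_to_roots_iso
          power_classes_exponent] .
    fix \<xi> \<alpha> assume *: "\<xi> \<in> Units L" "\<alpha> \<in> Units L" "\<xi> [^]\<^bsub>L\<^esub> (q - 1) = \<alpha> [^]\<^bsub>L\<^esub> e"
    show "H2q_class q f ?C (class_mod_powers L e \<xi>) \<in> carrier (H2q q f ?C)"
      using main(1)[OF *] .
    show "galois_norm L K \<alpha> \<in> kernel ?D ?D (\<lambda>x. x [^]\<^bsub>?D\<^esub> (q - 1))"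
      using main(2)[OF *] .
    show "H2q_map q f ?D ?\<phi> (H2q_class q f ?C (class_mod_powers L e \<xi>))
        = H2q_class q f ?D (galois_norm L K \<alpha>)"
      using main(3)[OF *] .
  qed (fact generate_frobenius galois_norm_hom group_module_power_classes group_module_unity_roots
      power_classes_to_roots_module_iso power_classes_to_roots_class)+
qed

end
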